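(* Let $a>0$, $t\in\mathbb{R}$ and $n\in\mathbb{N}$. Then for all $x$, $$\sum_{k=0}^n\frac{(-n)_k}{k!}\,C_{n-k}(x;a)\,e^{nt}(1-e^{-t})^k=C_n(x;ae^{-t}).$$
   Context: $\mathbb N=\{0,1,2,\dots\}$, $(y)_k=y(y+1)\cdots(y+k-1)$. The Charlier polynomials are $$C_n(x;a)=\sum_{j=0}^n\frac{(-n)_j(-x)_j}{j!}\left(-\frac1a\right)^j,$$ polynomials of degree $n$ in $x$. *)

theory Defs
  imports Complex_Main
begin

definition charlier :: "nat \<Rightarrow> 'a::field_char_0 \<Rightarrow> 'a \<Rightarrow> 'a" where
  "charlier n x a =
     (\<Sum>j=0..n. pochhammer (- of_nat n) j * pochhammer (- x) j / fact j * (- (1 / a)) ^ j)"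

end

theory Submission
  imports Defs
begin

text \<open>
  Since \<open>(-n)\<^sub>j / j! = (-1)\<^sup>j (n choose j)\<close>, the two signs in the Charlier sum cancel and
  \<open>C\<^sub>n(x;a)\<close> is the binomial transform \<open>\<Sum>\<^sub>j (n choose j) u\<^sub>j\<close> of the sequence
  \<open>u\<^sub>j = (-x)\<^sub>j a\<^sup>-\<^sup>j\<close>, which is independent of \<open>n\<close> (lemma \<open>charlier_binomial\<close>). Rescaling
  \<open>a\<close> to \<open>a q\<close> replaces \<open>u\<^sub>j\<close> by \<open>u\<^sub>j q\<^sup>-\<^sup>j\<close>. On the other side,
  the weights \<open>(-n)\<^sub>k / k! (1 - q)\<^sup>k = (n choose k) (q - 1)\<^sup>k\<close> form a second binomial convolution.
  Composing the two and summing over \<open>k\<close> by the binomial theorem gives \<open>u\<^sub>j\<close> the coefficient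
  \<open>(n choose j) q\<^sup>n\<^sup>-\<^sup>j\<close> (lemma \<open>binomial_transform_compose\<close>), which is \<open>q\<^sup>n\<close> times its
  coefficient in \<open>C\<^sub>n(x;a q)\<close>. The theorem is the case \<open>q = e\<^sup>-\<^sup>t\<close>.
\<close>

lemma pochhammer_minus_of_nat_div_fact:
  "pochhammer (- of_nat n) k / fact k = (- 1) ^ k * (of_nat (n choose k) :: 'a::field_char_0)"
  by (simp add: binomial_gbinomial gbinomial_pochhammer)

lemma charlier_binomial:
  "charlier n x a = (\<Sum>j\<le>n. of_nat (n choose j) * (pochhammer (- x) j * (1 / a) ^ j))"
proof -
  have "pochhammer (- of_nat n) j * pochhammer (- x) j / fact j * (- (1 / a)) ^ j
      = of_nat (n choose j) * (pochhammer (- x) j * (1 / a) ^ j)" for j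
  proof -
    have "pochhammer (- of_nat n) j * pochhammer (- x) j / fact j * (- (1 / a)) ^ j
        = pochhammer (- of_nat n) j / fact j * pochhammer (- x) j * ((- 1) ^ j * (1 / a) ^ j)"
      by (simp add: power_minus[of "1 / a"])
    also have "\<dots> = ((- 1) ^ j * (- 1) ^ j) * of_nat (n choose j) * (pochhammer (- x) j * (1 / a) ^ j)"
      unfolding pochhammer_minus_of_nat_div_fact by (simp only: mult_ac)
    finally show ?thesis
      by (simp flip: power_mult_distrib)
  qed
  then show ?thesis
    by (simp add: charlier_def atLeast0AtMost)
qed

text \<open>
  Both sides count ordered pairs of disjoint subsets of sizes \<open>k\<close> and \<open>j\<close>. They vanish together
  when \<open>k + j > n\<close>, so the ranges of summation below can be taken rectangular.
\<close>

lemma choose_choose_diff_commute: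
  assumes "k \<le> n" "j \<le> n"
  shows "(n choose k) * (n - k choose j) = (n choose j) * (n - j choose k)"
proof (cases "k + j \<le> n")
  case True
  have "(n choose (k + j)) * (k + j choose k) = (n choose k) * (n - k choose j)"
    using choose_mult[of k "k + j" n] True by simp
  moreover have "(n choose (k + j)) * (k + j choose j) = (n choose j) * (n - j choose k)"
    using choose_mult[of j "k + j" n] True by simp
  moreover have "(k + j choose k) = (k + j choose j)"
    using binomial_symmetric[of k "k + j"] by simp
  ultimately show ?thesis by simp
next
  case False
  with assms have "n - k < j" "n - j < k" by linarith+
  then show ?thesis by (simp add: binomial_eq_0)
qed

text \<open>
  In terms of exponential generating functions, the binomial transform is multiplication by
  \<open>exp z\<close> and the convolution with powers of \<open>c\<close> is multiplication by \<open>exp (c z)\<close>; their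
  composition is multiplication by \<open>exp ((1 + c) z)\<close>.
\<close>

lemma binomial_transform_compose:
  fixes c :: "'a::comm_semiring_1"
  shows "(\<Sum>k\<le>n. of_nat (n choose k) * c ^ k * (\<Sum>j\<le>n - k. of_nat (n - k choose j) * u j))
       = (\<Sum>j\<le>n. of_nat (n choose j) * (1 + c) ^ (n - j) * u j)"
proof -
  have ext: "(\<Sum>j\<le>m. of_nat (m choose j) * f j) = (\<Sum>j\<le>n. of_nat (m choose j) * f j)"
    if "m \<le> n" for m and f :: "nat \<Rightarrow> 'a"
    using that by (intro sum.mono_neutral_left) (auto simp: binomial_eq_0)
  have "(\<Sum>k\<le>n. of_nat (n choose k) * c ^ k * (\<Sum>j\<le>n - k. of_nat (n - k choose j) * u j))
      = (\<Sum>k\<le>n. \<Sum>j\<le>n. of_nat ((n choose k) * (n - k choose j)) * c ^ k * u j)"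
    unfolding ext[OF diff_le_self] by (simp add: sum_distrib_left mult_ac)
  also have "\<dots> = (\<Sum>k\<le>n. \<Sum>j\<le>n. of_nat ((n choose j) * (n - j choose k)) * c ^ k * u j)"
    by (intro sum.cong refl) (simp only: choose_choose_diff_commute atMost_iff)
  also have "\<dots> = (\<Sum>j\<le>n. of_nat (n choose j) * (\<Sum>k\<le>n. of_nat (n - j choose k) * c ^ k) * u j)"
    by (subst sum.swap) (simp add: sum_distrib_left sum_distrib_right mult_ac)
  also have "\<dots> = (\<Sum>j\<le>n. of_nat (n choose j) * (1 + c) ^ (n - j) * u j)"
    using binomial_ring[of c 1] by (simp add: ext[OF diff_le_self, symmetric] add.commute)
  finally show ?thesis .
qed

lemma charlier_rescale:
  fixes q :: "'a::field_char_0"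
  assumes "q \<noteq> 0"
  shows "(\<Sum>k\<le>n. pochhammer (- of_nat n) k / fact k * charlier (n - k) x a * (1 - q) ^ k)
       = q ^ n * charlier n x (a * q)"
proof -
  have sgn: "(- 1) ^ k * (1 - q) ^ k = (q - 1) ^ k" for k
    by (simp flip: power_mult_distrib)
  have "(\<Sum>k\<le>n. pochhammer (- of_nat n) k / fact k * charlier (n - k) x a * (1 - q) ^ k)
      = (\<Sum>k\<le>n. of_nat (n choose k) * (q - 1) ^ k * charlier (n - k) x a)"
    unfolding pochhammer_minus_of_nat_div_fact sgn[symmetric] by (simp only: mult_ac)
  also have "\<dots> = (\<Sum>j\<le>n. of_nat (n choose j) * q ^ (n - j) * (pochhammer (- x) j * (1 / a) ^ j))"
    unfolding charlier_binomial binomial_transform_compose by simp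
  also have "\<dots> = (\<Sum>j\<le>n. q ^ n * (of_nat (n choose j) * (pochhammer (- x) j * (1 / (a * q)) ^ j)))"
    using assms by (intro sum.cong refl) (simp add: power_diff power_divide power_mult_distrib mult_ac)
  finally show ?thesis
    by (simp add: charlier_binomial sum_distrib_left)
qed

theorem mainTheorem18:
  fixes a t :: real and n :: nat and x :: complex
  assumes "a > 0"
  shows "(\<Sum>k=0..n. pochhammer (- of_nat n) k / fact k
            * charlier (n - k) x (complex_of_real a)
            * complex_of_real (exp (real n * t) * (1 - exp (- t)) ^ k))
         = charlier n x (complex_of_real (a * exp (- t)))"
proof -
  define q where "q = complex_of_real (exp (- t))"
  have "q \<noteq> 0"
    by (simp add: q_def)
  have "exp (real n * t) * exp (- t) ^ n = 1"
    by (simp flip: exp_of_nat_mult exp_add)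
  then have inv: "complex_of_real (exp (real n * t)) * q ^ n = 1"
    unfolding q_def by (metis of_real_1 of_real_mult of_real_power)
  have "(\<Sum>k=0..n. pochhammer (- of_nat n) k / fact k
            * charlier (n - k) x (complex_of_real a)
            * complex_of_real (exp (real n * t) * (1 - exp (- t)) ^ k))
      = complex_of_real (exp (real n * t)) *
        (\<Sum>k\<le>n. pochhammer (- of_nat n) k / fact k * charlier (n - k) x (complex_of_real a)
              * (1 - q) ^ k)"
    unfolding sum_distrib_left atLeast0AtMost q_def of_real_mult of_real_power of_real_diff of_real_1
    by (simp only: mult_ac)
  also have "\<dots> = complex_of_real (exp (real n * t)) * q ^ n * charlier n x (complex_of_real a * q)"
    by (simp only: charlier_rescale[OF \<open>q \<noteq> 0\<close>] mult.assoc[of _ "q ^ n"])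
  also have "\<dots> = charlier n x (complex_of_real (a * exp (- t)))"
    unfolding inv by (simp add: q_def)
  finally show ?thesis .
qed

end
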